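(* Let $X$ be a completely regular Hausdorff space with $|X|>1$. Then the line graph $L(\Gamma(C(X)))$ is not chordal.
   Context: $C(X)$ is the ring of all continuous functions $X\to\mathbb{R}$ with pointwise operations. For $f\in C(X)$, $Z(f)=\{x\in X: f(x)=0\}$. $\Gamma(C(X))$ is the simple graph whose vertex set is the set of non-units of $C(X)$ (equivalently, the $f$ with $Z(f)\neq\emptyset$), two distinct vertices $f,g$ being adjacent iff $Z(f)\cap Z(g)\neq\emptyset$. Its line graph $L(\Gamma(C(X)))$ has as vertices the unordered pairs $[f,g]=[g,f]$ of distinct vertices $f,g$ of $\Gamma(C(X))$ with $Z(f)\cap Z(g)\neq\emptyset$; two distinct vertices $[f_1,f_2]$, $[g_1,g_2]$ are adjacent iff $f_i=g_j$ for some $i,j\in\{1,2\}$. A graph is chordal if every cycle of length greater than three has a chord (an edge joining two vertices of the cycle that is not an edge of the cycle). *)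

theory Defs
  imports "HOL-Analysis.Analysis" "HOL-Algebra.Ring"
begin

text \<open>Simple graphs: an edge is the two-element set of its endpoints.\<close>

record 'v graph =
  verts :: "'v set"
  edges :: "'v set set"

definition simple_graph :: "'v graph \<Rightarrow> bool" where
  "simple_graph G \<longleftrightarrow> (\<forall>e \<in> edges G. e \<subseteq> verts G \<and> card e = 2)"

definition line_graph :: "'v graph \<Rightarrow> 'v set graph" where
  "line_graph G =
     \<lparr>verts = edges G,
      edges = {{e, e'} | e e'. e \<in> edges G \<and> e' \<in> edges G \<and> e \<noteq> e' \<and> e \<inter> e' \<noteq> {}}\<rparr>"

text \<open>A cycle is given by the list of its vertices in cyclic order, without repeating the first
  vertex at the end; its length is the length of the list.\<close>

definition cycle_edges :: "'v list \<Rightarrow> 'v set set" where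
  "cycle_edges vs = {{vs ! i, vs ! (Suc i mod length vs)} | i. i < length vs}"

definition is_cycle :: "'v graph \<Rightarrow> 'v list \<Rightarrow> bool" where
  "is_cycle G vs \<longleftrightarrow>
     length vs \<ge> 3 \<and> distinct vs \<and> set vs \<subseteq> verts G \<and> cycle_edges vs \<subseteq> edges G"

definition is_chord :: "'v graph \<Rightarrow> 'v list \<Rightarrow> 'v set \<Rightarrow> bool" where
  "is_chord G vs e \<longleftrightarrow> e \<in> edges G \<and> e \<subseteq> set vs \<and> e \<notin> cycle_edges vs"

definition chordal :: "'v graph \<Rightarrow> bool" where
  "chordal G \<longleftrightarrow> (\<forall>vs. is_cycle G vs \<and> length vs > 3 \<longrightarrow> (\<exists>e. is_chord G vs e))"

lemma simple_graph_line_graph: "simple_graph (line_graph G)"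
  by (auto simp: simple_graph_def line_graph_def card_insert_if)

text \<open>The ring of real-valued continuous functions on a space. Its elements are required to be
  \<^const>\<open>undefined\<close> off the carrier of the space, so that two of them are equal as HOL functions
  exactly when they agree on the space.\<close>

definition C_ring :: "'a topology \<Rightarrow> ('a \<Rightarrow> real) ring" where
  "C_ring X =
     \<lparr>carrier = {f \<in> extensional (topspace X). continuous_map X euclideanreal f},
      mult = (\<lambda>f g. \<lambda>x\<in>topspace X. f x * g x),
      one = (\<lambda>x\<in>topspace X. 1),
      zero = (\<lambda>x\<in>topspace X. 0),
      add = (\<lambda>f g. \<lambda>x\<in>topspace X. f x + g x)\<rparr>"

definition zero_set :: "'a topology \<Rightarrow> ('a \<Rightarrow> real) \<Rightarrow> 'a set" where
  "zero_set X f = {x \<in> topspace X. f x = 0}"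

definition nonunits :: "('b, 'm) ring_scheme \<Rightarrow> 'b set" where
  "nonunits R = carrier R - Units R"

definition Gamma_C :: "'a topology \<Rightarrow> ('a \<Rightarrow> real) graph" where
  "Gamma_C X =
     \<lparr>verts = nonunits (C_ring X),
      edges = {{f, g} | f g. f \<in> nonunits (C_ring X) \<and> g \<in> nonunits (C_ring X) \<and> f \<noteq> g
                 \<and> zero_set X f \<inter> zero_set X g \<noteq> {}}\<rparr>"

lemma simple_graph_Gamma_C: "simple_graph (Gamma_C X)"
  by (auto simp: simple_graph_def Gamma_C_def card_insert_if)

lemma continuous_map_restrict_iff:
  "continuous_map X Y (restrict f (topspace X)) \<longleftrightarrow> continuous_map X Y f"
  by (rule iffI; erule continuous_map_eq; simp)

lemma cring_C_ring: "cring (C_ring X)"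
proof (rule cringI)
  show "abelian_group (C_ring X)"
  proof (rule abelian_groupI)
    fix f assume "f \<in> carrier (C_ring X)"
    then have "(\<lambda>x\<in>topspace X. - f x) \<in> carrier (C_ring X)"
      "(\<lambda>x\<in>topspace X. - f x) \<oplus>\<^bsub>C_ring X\<^esub> f = \<zero>\<^bsub>C_ring X\<^esub>"
      by (auto simp: C_ring_def continuous_map_restrict_iff intro!: continuous_intros)
    then show "\<exists>g\<in>carrier (C_ring X). g \<oplus>\<^bsub>C_ring X\<^esub> f = \<zero>\<^bsub>C_ring X\<^esub>"
      by blast
  qed (auto simp: C_ring_def continuous_map_restrict_iff extensional_def fun_eq_iff
         intro!: continuous_intros)
  show "Group.comm_monoid (C_ring X)"
    by (rule comm_monoidI)
      (auto simp: C_ring_def continuous_map_restrict_iff extensional_def fun_eq_iff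
         intro!: continuous_intros)
qed (auto simp: C_ring_def fun_eq_iff distrib_right)

lemma nonunits_C_ring:
  "nonunits (C_ring X) = {f \<in> carrier (C_ring X). zero_set X f \<noteq> {}}"
proof -
  have "f \<in> Units (C_ring X) \<longleftrightarrow> zero_set X f = {}" if f: "f \<in> carrier (C_ring X)" for f
  proof
    assume "f \<in> Units (C_ring X)"
    then obtain g where g: "g \<otimes>\<^bsub>C_ring X\<^esub> f = \<one>\<^bsub>C_ring X\<^esub>"
      unfolding Units_def by blast
    have "g x * f x = 1" if "x \<in> topspace X" for x
      using fun_cong[OF g, of x] that by (simp add: C_ring_def)
    then show "zero_set X f = {}"
      by (force simp: zero_set_def)
  next
    assume "zero_set X f = {}"
    then have nz: "f x \<noteq> 0" if "x \<in> topspace X" for x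
      using that by (auto simp: zero_set_def)
    have "(\<lambda>x\<in>topspace X. inverse (f x)) \<in> carrier (C_ring X)"
      using f nz by (auto simp: C_ring_def continuous_map_restrict_iff
          intro!: continuous_map_real_inverse)
    moreover have "(\<lambda>x\<in>topspace X. inverse (f x)) \<otimes>\<^bsub>C_ring X\<^esub> f = \<one>\<^bsub>C_ring X\<^esub>"
      "f \<otimes>\<^bsub>C_ring X\<^esub> (\<lambda>x\<in>topspace X. inverse (f x)) = \<one>\<^bsub>C_ring X\<^esub>"
      using nz by (auto simp: C_ring_def fun_eq_iff)
    ultimately show "f \<in> Units (C_ring X)"
      using f unfolding Units_def by blast
  qed
  then show ?thesis
    by (auto simp: nonunits_def)
qed

end

theory Submission
  imports Defs
begin

text \<open>A function \<open>f\<close> with \<open>f x = 0\<close> and \<open>f y = 1\<close> has four distinct multiples \<open>f, 2f, 3f, 4f\<close>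
  sharing the zero \<open>x\<close>, so they form a 4-cycle of \<open>\<Gamma>(C(X))\<close>. Consecutive edges of a 4-cycle meet and
  opposite ones are disjoint, so its line graph contains an induced 4-cycle.\<close>

lemma cycle_edges_4: "cycle_edges [a, b, c, d] = {{a, b}, {b, c}, {c, d}, {d, a}}"
proof -
  \<comment> \<open>As an image over an index set, the edges can be computed by \<open>simp\<close>;
    the wrap-around at index 3 yields \<open>{d, a}\<close>.\<close>
  have "cycle_edges vs = (\<lambda>i. {vs ! i, vs ! (Suc i mod length vs)}) ` {..<length vs}" for vs :: "'a list"
    by (auto simp: cycle_edges_def)
  moreover have "{..<length [a, b, c, d]} = {0, 1, 2, 3}"
    by auto
  ultimately show ?thesis
    by simp
qed

text \<open>The 4-cycle may have diagonals in \<open>G\<close>: a diagonal such as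
  \<open>{a, c}\<close> is a further vertex of the line graph, off the cycle \<open>?vs\<close>, so
  it cannot supply a chord.\<close>

lemma not_chordal_line_graph:
  assumes cyc: "distinct [a, b, c, d]" "cycle_edges [a, b, c, d] \<subseteq> edges G"
  shows "\<not> chordal (line_graph G)"
proof
  let ?vs = "[{a, b}, {b, c}, {c, d}, {d, a}]"
  have mem: "{a, b} \<in> edges G" "{b, c} \<in> edges G" "{c, d} \<in> edges G" "{d, a} \<in> edges G"
    using cyc(2) by (auto simp: cycle_edges_4)
  have adj: "{e, e'} \<in> edges (line_graph G)"
    if "e \<in> edges G" "e' \<in> edges G" "e \<noteq> e'" "e \<inter> e' \<noteq> {}" for e e'
    using that by (auto simp: line_graph_def)
  have ne: "distinct ?vs"
    using cyc(1) by (auto simp: doubleton_eq_iff)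
  have "is_cycle (line_graph G) ?vs"
    unfolding is_cycle_def
  proof (intro conjI)
    show "set ?vs \<subseteq> verts (line_graph G)"
      using mem by (simp add: line_graph_def)
    show "cycle_edges ?vs \<subseteq> edges (line_graph G)"
      unfolding cycle_edges_4 insert_subset using cyc(1)
      by (intro conjI adj mem) (auto simp: doubleton_eq_iff)
  qed (use ne in simp_all)
  moreover assume "chordal (line_graph G)"
  ultimately obtain e where e: "is_chord (line_graph G) ?vs e"
    unfolding chordal_def by force
  then obtain p q where pq: "e = {p, q}" "p \<noteq> q" "p \<inter> q \<noteq> {}"
    by (auto simp: is_chord_def line_graph_def)
  then have "p \<in> set ?vs" "q \<in> set ?vs"
    using e by (auto simp: is_chord_def)
  then have "p = {a, b} \<or> p = {b, c} \<or> p = {c, d} \<or> p = {d, a}"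
    "q = {a, b} \<or> q = {b, c} \<or> q = {c, d} \<or> q = {d, a}"
    by simp_all
  \<comment> \<open>Among the sixteen cases, \<open>p = q\<close> and disjoint opposite edges are
    excluded; only consecutive pairs remain, and these are edges of the cycle itself.\<close>
  then have "e \<in> cycle_edges ?vs"
    unfolding cycle_edges_4 pq(1) using pq(2,3) cyc(1)
    by (elim disjE) (auto simp: doubleton_eq_iff)
  with e show False
    by (simp add: is_chord_def)
qed

theorem theorem5p9:
  fixes X :: "'a topology"
  assumes "completely_regular_space X" and "Hausdorff_space X"
    and "\<exists>x \<in> topspace X. \<exists>y \<in> topspace X. x \<noteq> y"
  shows "\<not> chordal (line_graph (Gamma_C X))"
proof -
  obtain x y where xy: "x \<in> topspace X" "y \<in> topspace X" "x \<noteq> y"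
    using assms(3) by blast
  have "closedin X {y}"
    using assms(2) xy(2) by (simp add: closedin_Hausdorff_singleton)
  \<comment> \<open>Complete regularity separates \<open>x\<close> from the closed set
    \<open>{y}\<close>.\<close>
  then obtain f where f: "continuous_map X euclideanreal f" "f x = 0" "f y = 1"
    using assms(1) xy unfolding completely_regular_space_def
    by (force simp: continuous_map_in_subtopology)
  \<comment> \<open>Every multiple keeps the zero \<open>x\<close>, and its value \<open>k\<close>
    at \<open>y\<close> tells the multiples apart. Restriction makes them extensional, as the
    carrier demands.\<close>
  define g where "g k = (\<lambda>z\<in>topspace X. k * f z)" for k
  have zero: "x \<in> zero_set X (g k)" for k
    using f xy by (simp add: zero_set_def g_def)
  have "g k \<in> carrier (C_ring X)" for k
    using f(1) by (auto simp: C_ring_def g_def continuous_map_restrict_iff intro!: continuous_intros)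
  with zero have vert: "g k \<in> nonunits (C_ring X)" for k
    by (auto simp: nonunits_C_ring)
  have inj: "g k \<noteq> g l" if "k \<noteq> l" for k l
    using that f(3) xy(2) by (auto simp: g_def dest!: fun_cong[of _ _ y])
  have edge: "{g k, g l} \<in> edges (Gamma_C X)" if "k \<noteq> l" for k l
    using vert zero[of k] zero[of l] inj[OF that] unfolding Gamma_C_def by force
  show ?thesis
    \<comment> \<open>The \<open>g k\<close> are pairwise adjacent, so any four distinct scalars
      give a 4-cycle.\<close>
    by (rule not_chordal_line_graph[of "g 1" "g 2" "g 3" "g 4"])
      (auto simp: inj edge cycle_edges_4)
qed

end
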